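(* A tuple $a_i\in\mathbb R_{>0}$, for $i=1,\ldots,n$, occurs as the measure on the frontier edges of a polygon $P$ for a balanced measured lamination if and only if it satisfies the tropical generalized triangle inequalities, i.e. for each $i=1,\ldots,n$, we have $a_i\le\max\{a_j: j\ne i\}$. Furthermore, such tuples of measures on the frontier edges of $P$ uniquely determine the corresponding balanced measured lamination on $P$.
   Context: $P$ is a polygon with $n\ge3$ sides (the tuple is listed in the cyclic order of the frontier edges). An ideal triangulation of $P$ is a decomposition of $P$ into triangles by diagonals (arcs joining vertices of $P$); it is understood to include the frontier edges. A measured lamination of $P$ is described by its measures, real numbers assigned to the frontier edges and diagonals of $P$; it is determined by its measures on any one ideal triangulation, and the measures are related by the tropical Ptolemy equation: for any quadrilateral spanned by vertices of $P$ with diagonals $e,f$ and consecutive sides $a,b,c,d$ (so $a,c$ are opposite and $b,d$ are opposite), $e+f=\max\{a+c,b+d\}$, where an arc is identified with its measure. A measured lamination of $P$ is balanced if for each ideal triangulation of $P$, the tropical triangle inequalities hold on each complementary triangle, i.e. if the triangle has sides $a,b,c$, then $a\le\max\{b,c\}$, $b\le\max\{a,c\}$, $c\le\max\{a,b\}$. *)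

theory Defs
  imports Complex_Main
begin

text \<open>
  The vertices of the polygon with \<open>n\<close> sides are \<open>0, \<dots>, n - 1\<close> in cyclic order. Up to isotopy an arc
  joining two vertices is determined by its end points, so it is represented by the two-element
  set of these; the frontier edges are among the arcs.
\<close>

definition arcs :: "nat \<Rightarrow> nat set set" where
  "arcs n = {{i, j} | i j. i < n \<and> j < n \<and> i \<noteq> j}"

definition frontier_edge :: "nat \<Rightarrow> nat \<Rightarrow> nat set" where
  "frontier_edge n i = {i, Suc i mod n}"

definition arcs_cross :: "nat set \<Rightarrow> nat set \<Rightarrow> bool" where
  "arcs_cross A B \<longleftrightarrow>
     (\<exists>i j k l. i < j \<and> j < k \<and> k < l \<and>
        (A = {i, k} \<and> B = {j, l} \<or> A = {j, l} \<and> B = {i, k}))"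

text \<open>
  The sides of the polygon spanned by a set \<open>V\<close> of vertices join cyclically consecutive elements
  of \<open>V\<close>: either nothing of \<open>V\<close> lies strictly between the two end points, or they are the least and
  the greatest element.
\<close>

definition sides :: "nat set \<Rightarrow> nat set set" where
  "sides V = {{i, j} | i j. i \<in> V \<and> j \<in> V \<and> i < j \<and> (V \<inter> {i<..<j} = {} \<or> V \<subseteq> {i..j})}"

text \<open>
  When the arcs in \<open>T\<close> are pairwise non-crossing and include the frontier edges, cutting the polygon
  along \<open>T\<close> leaves the subpolygons all of whose sides, but none of whose diagonals, belong to \<open>T\<close>.
  Such a subpolygon is given by its set \<open>V\<close> of vertices.
\<close>

definition complementary_region :: "nat \<Rightarrow> nat set set \<Rightarrow> nat set \<Rightarrow> bool" where
  "complementary_region n T V \<longleftrightarrow>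
     V \<subseteq> {..<n} \<and> 3 \<le> card V \<and> sides V \<subseteq> T \<and> (\<forall>A\<in>T. A \<subseteq> V \<longrightarrow> A \<in> sides V)"

definition ideal_triangulation :: "nat \<Rightarrow> nat set set \<Rightarrow> bool" where
  "ideal_triangulation n T \<longleftrightarrow>
     T \<subseteq> arcs n \<and> (\<forall>i<n. frontier_edge n i \<in> T) \<and>
     (\<forall>A\<in>T. \<forall>B\<in>T. \<not> arcs_cross A B) \<and>
     (\<forall>V. complementary_region n T V \<longrightarrow> card V = 3)"

text \<open>
  A measured lamination is given by its measures on all arcs, subject to the tropical Ptolemy
  equation for every quadrilateral. Values off \<^term>\<open>arcs n\<close> are irrelevant.
\<close>

definition measured_lamination :: "nat \<Rightarrow> (nat set \<Rightarrow> real) \<Rightarrow> bool" where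
  "measured_lamination n \<mu> \<longleftrightarrow>
     (\<forall>i j k l. i < j \<and> j < k \<and> k < l \<and> l < n \<longrightarrow>
        \<mu> {i, k} + \<mu> {j, l} = max (\<mu> {i, j} + \<mu> {k, l}) (\<mu> {j, k} + \<mu> {l, i}))"

definition tropical_triangle_ineqs :: "real \<Rightarrow> real \<Rightarrow> real \<Rightarrow> bool" where
  "tropical_triangle_ineqs a b c \<longleftrightarrow> a \<le> max b c \<and> b \<le> max a c \<and> c \<le> max a b"

definition balanced :: "nat \<Rightarrow> (nat set \<Rightarrow> real) \<Rightarrow> bool" where
  "balanced n \<mu> \<longleftrightarrow>
     (\<forall>T. ideal_triangulation n T \<longrightarrow>
        (\<forall>i j k. i < j \<and> j < k \<and> complementary_region n T {i, j, k} \<longrightarrow>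
           tropical_triangle_ineqs (\<mu> {i, j}) (\<mu> {j, k}) (\<mu> {k, i})))"

end

theory Submission
  imports Defs
begin

text \<open>
  Every triangle occurs in some ideal triangulation, so balanced means that the measure \<open>\<mu>\<close> is an
  ultrametric on the vertices (possibly with values of either sign), and \<open>\<mu> {x, y} \<le> r\<close> is then
  essentially an equivalence relation. The two boundary paths from \<open>i\<close> to \<open>j\<close> bound \<open>\<mu> {i, j}\<close> from
  above by the smaller of the two maximal edge measures along them.

  This bound is attained. Suppose that \<open>\<mu> {i, j} = r\<close> while both paths contain an edge of measure
  larger than \<open>r\<close>. Then there are vertices \<open>p\<close>, \<open>q\<close>, one on each path, that are not equivalent to
  \<open>i\<close>. With \<open>x = \<mu> {i, p} = \<mu> {p, j} > r\<close> and \<open>y = \<mu> {i, q} = \<mu> {q, j} > r\<close> the Ptolemy equation gives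
  \<open>\<mu> {p, q} = x + y - r > max x y\<close>, contradicting the ultrametric inequality. This proves uniqueness.
  For existence, the minimum of the two maxima is checked to satisfy all conditions.
\<close>

section \<open>Triangles in ideal triangulations\<close>

lemma arcs_cross_iff:
  assumes "x < y" "u < w"
  shows "arcs_cross {x, y} {u, w} \<longleftrightarrow> x < u \<and> u < y \<and> y < w \<or> u < x \<and> x < w \<and> w < y"
  using assms unfolding arcs_cross_def doubleton_eq_iff
  by (smt (verit, ccfv_threshold) order.strict_trans order_less_imp_not_less)

lemma arcs_cross_commute: "arcs_cross A B \<longleftrightarrow> arcs_cross B A"
  unfolding arcs_cross_def by blast

lemma arcsE:
  assumes "A \<in> arcs n"
  obtains x y where "x < y" "y < n" "A = {x, y}"
proof -
  obtain i j where "i < n" "j < n" "i \<noteq> j" "A = {i, j}"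
    using assms unfolding arcs_def by blast
  then show thesis
    using that[of i j] that[of j i] by (metis insert_commute nat_neq_iff)
qed

lemma arcsI: "x < y \<Longrightarrow> y < n \<Longrightarrow> {x, y} \<in> arcs n"
  unfolding arcs_def by fastforce

lemma finite_arcs: "finite (arcs n)"
proof -
  have "arcs n \<subseteq> Pow {..<n}"
    unfolding arcs_def by auto
  then show ?thesis
    by (rule finite_subset) simp
qed

lemma frontier_edge_cases:
  assumes "i < n"
  shows "Suc i < n \<and> frontier_edge n i = {i, Suc i} \<or> Suc i = n \<and> frontier_edge n i = {0, i}"
proof (cases "Suc i = n")
  case True
  then show ?thesis unfolding frontier_edge_def by (auto simp: insert_commute)
next
  case False
  then have "Suc i < n" using assms by simp
  then show ?thesis unfolding frontier_edge_def by simp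
qed

lemma frontier_edge_in_arcs:
  assumes "2 \<le> n" "i < n"
  shows "frontier_edge n i \<in> arcs n"
  using frontier_edge_cases[OF assms(2)] assms
  by (auto intro!: arcsI)

text \<open>No vertex lies strictly between \<open>i\<close> and \<open>Suc i\<close>, and none lies
  outside the range from \<open>0\<close> to \<open>n - 1\<close>, so no arc has ends on both sides
  of a frontier edge.\<close>

lemma frontier_edge_not_cross:
  assumes "2 \<le> n" "i < n" "B \<in> arcs n"
  shows "\<not> arcs_cross (frontier_edge n i) B"
proof -
  obtain u w where uw: "u < w" "w < n" "B = {u, w}"
    using assms(3) by (rule arcsE)
  show ?thesis
    using frontier_edge_cases[OF assms(2)]
  proof
    assume "Suc i < n \<and> frontier_edge n i = {i, Suc i}"
    then show ?thesis using uw by (simp add: arcs_cross_iff)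
  next
    assume *: "Suc i = n \<and> frontier_edge n i = {0, i}"
    then have "0 < i" using assms by simp
    then show ?thesis using * uw by (simp add: arcs_cross_iff)
  qed
qed

text \<open>If a region had four or more vertices, its diagonal \<open>{v0, v2}\<close> would be
  missing from \<open>T\<close>, so by maximality some \<open>B\<close> in \<open>T\<close> crosses
  it. Since \<open>B\<close> crosses no side of \<open>V\<close>, it starts at \<open>v1\<close>.
  Its other end is either in \<open>V\<close>, making \<open>B\<close> a diagonal of the region that
  belongs to \<open>T\<close>, or strictly between consecutive vertices of \<open>V\<close>, making
  \<open>B\<close> cross a side.\<close>

lemma region_of_maximal_noncrossing:
  assumes T: "T \<subseteq> arcs n" "\<forall>A\<in>T. \<forall>B\<in>T. \<not> arcs_cross A B"
    and maximal: "\<And>D. D \<in> arcs n \<Longrightarrow> D \<notin> T \<Longrightarrow> \<exists>B\<in>T. arcs_cross D B"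
    and V: "complementary_region n T V"
  shows "card V = 3"
proof (rule ccontr)
  assume "card V \<noteq> 3"
  then have card: "4 \<le> card V"
    using V unfolding complementary_region_def by simp
  have VT: "V \<subseteq> {..<n}" "sides V \<subseteq> T" "\<And>A. A \<in> T \<Longrightarrow> A \<subseteq> V \<Longrightarrow> A \<in> sides V"
    using V unfolding complementary_region_def by auto
  have fin: "finite V"
    using VT(1) finite_subset by blast
  define v0 where "v0 = Min V"
  define v1 where "v1 = Min (V - {v0})"
  define v2 where "v2 = Min (V - {v0, v1})"
  define m where "m = Max V"
  have ne0: "V \<noteq> {}" using card by auto
  have ne: "V - F \<noteq> {}" if "finite F" "card F < 4" for F
    using that card card_mono[of F V] by auto
  have ne1: "V - {v0} \<noteq> {}" by (rule ne) auto
  have ne2: "V - {v0, v1} \<noteq> {}"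
    by (rule ne) (auto intro: le_less_trans[OF card_insert_le_m1])
  have ne3: "V - {v0, v1, v2} \<noteq> {}"
    by (rule ne) (auto simp: card_insert_if)
  have v0: "v0 \<in> V" "\<And>v. v \<in> V \<Longrightarrow> v0 \<le> v"
    unfolding v0_def using fin ne0 by auto
  have v1: "v1 \<in> V - {v0}" "\<And>v. v \<in> V - {v0} \<Longrightarrow> v1 \<le> v"
    unfolding v1_def using fin ne1 by (auto intro!: Min_le simp del: Diff_iff)
  have v2: "v2 \<in> V - {v0, v1}" "\<And>v. v \<in> V - {v0, v1} \<Longrightarrow> v2 \<le> v"
    unfolding v2_def using fin ne2 Min_in[of "V - {v0, v1}"] by (auto intro!: Min_le)
  have m: "m \<in> V" "\<And>v. v \<in> V \<Longrightarrow> v \<le> m"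
    unfolding m_def using fin ne0 by auto
  obtain v3 where v3: "v3 \<in> V" "v3 \<noteq> v0" "v3 \<noteq> v1" "v3 \<noteq> v2" using ne3 by blast
  have order: "v0 < v1" "v1 < v2" "v2 < v3" "v3 \<le> m"
    using v0(2)[of v1] v1 v1(2)[of v2] v2 v2(2)[of v3] v3 m(2)[of v3] by force+
  have consecutive: "{s, t} \<in> T" if "s \<in> V" "t \<in> V" "s < t" "\<And>v. v \<in> V \<Longrightarrow> s < v \<Longrightarrow> v < t \<Longrightarrow> False" for s t
    using that VT(2) unfolding sides_def by fastforce
  have s01: "{v0, v1} \<in> T"
    using v0 v1 order by (intro consecutive) force+
  have s12: "{v1, v2} \<in> T"
    using v0 v1 v2 order by (intro consecutive) force+
  have s0m: "{v0, m} \<in> T"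
  proof -
    have "v0 < m" "V \<subseteq> {v0..m}" using order v0 m by auto
    then show ?thesis using v0(1) m(1) VT(2) unfolding sides_def by blast
  qed
  have side_iff: "V \<inter> {x<..<y} = {} \<or> V \<subseteq> {x..y}" if "{x, y} \<in> sides V" "x < y" for x y
    using that unfolding sides_def by (auto simp: doubleton_eq_iff)
  \<comment> \<open>As an element of \<open>T\<close> it would be a side of \<open>V\<close>, but
    \<open>v1\<close> lies between its ends and \<open>v3\<close> beyond them.\<close>
  have "{v0, v2} \<notin> T"
  proof
    assume "{v0, v2} \<in> T"
    then have "V \<inter> {v0<..<v2} = {} \<or> V \<subseteq> {v0..v2}"
      using VT(3) v0 v2 order by (intro side_iff) auto
    then show False using v1(1) v3(1) order by force
  qed
  moreover have "{v0, v2} \<in> arcs n"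
    using VT(1) v2 order by (intro arcsI) auto
  ultimately obtain B where B: "B \<in> T" "arcs_cross {v0, v2} B"
    using maximal by blast
  obtain x y where xy: "x < y" "y < n" "B = {x, y}"
    using B(1) T(1) by (blast elim: arcsE)
  have no_cross: "\<not> (x < s \<and> s < y \<and> y < t \<or> s < x \<and> x < t \<and> t < y)" if "{s, t} \<in> T" "s < t" for s t
    using T(2) B(1) xy that arcs_cross_iff[of x y s t] by blast
  have "v0 < x \<and> x < v2 \<and> v2 < y \<or> x < v0 \<and> v0 < y \<and> y < v2"
    using B(2) xy order arcs_cross_iff[of v0 v2 x y] by auto
  \<comment> \<open>Any other position of \<open>x\<close> makes \<open>B\<close> cross one of the
    sides \<open>{v0, v1}\<close>, \<open>{v1, v2}\<close>, \<open>{v0, m}\<close>.\<close>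
  then have x: "x = v1" "v2 < y"
    using no_cross[OF s01] no_cross[OF s12] no_cross[OF s0m] order by linarith+
  have "y \<le> m"
    using no_cross[OF s0m] x order by linarith
  have "y \<notin> V"
  proof
    assume "y \<in> V"
    then have "V \<inter> {x<..<y} = {} \<or> V \<subseteq> {x..y}"
      using VT(3) v1 B(1) xy x by (intro side_iff) auto
    then show False using v0(1) v2(1) x order by force
  qed
  \<comment> \<open>\<open>s\<close> and \<open>t\<close> are the neighbours of \<open>y\<close> in
    \<open>V\<close>. They span a side, and \<open>B\<close> crosses it because
    \<open>v1 < v2 \<le> s < y < t\<close>.\<close>
  define s where "s = Max {v \<in> V. v < y}"
  define t where "t = Min {v \<in> V. y < v}"
  have "v2 \<in> {v \<in> V. v < y}" "m \<in> {v \<in> V. y < v}"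
    using v2 x m \<open>y \<le> m\<close> \<open>y \<notin> V\<close> by (auto simp: order_less_le)
  then have "{v \<in> V. v < y} \<noteq> {}" "{v \<in> V. y < v} \<noteq> {}"
    by blast+
  then have "s \<in> {v \<in> V. v < y}" "t \<in> {v \<in> V. y < v}"
    unfolding s_def t_def using Max_in[of "{v \<in> V. v < y}"] Min_in[of "{v \<in> V. y < v}"] fin
    by simp_all
  moreover have "v \<le> s" if "v \<in> V" "v < y" for v
    unfolding s_def using that fin by (intro Max_ge) auto
  moreover have "t \<le> v" if "v \<in> V" "y < v" for v
    unfolding t_def using that fin by (intro Min_le) auto
  ultimately have s: "s \<in> V" "s < y" "\<And>v. v \<in> V \<Longrightarrow> v < y \<Longrightarrow> v \<le> s"
    and t: "t \<in> V" "y < t" "\<And>v. v \<in> V \<Longrightarrow> y < v \<Longrightarrow> t \<le> v"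
    by simp_all
  have "{s, t} \<in> T"
    using s t \<open>y \<notin> V\<close> by (intro consecutive) (auto, metis linorder_not_le nat_neq_iff)
  moreover have "v2 \<le> s"
    using s(3) v2 x by blast
  ultimately show False
    using no_cross[of s t] s t x order by linarith
qed

text \<open>There are finitely many arcs, so some non-crossing family containing \<open>S\<close> is
  maximal under inclusion, and its complementary regions are triangles.\<close>

lemma extend_to_ideal_triangulation:
  assumes S: "S \<subseteq> arcs n" "\<forall>i<n. frontier_edge n i \<in> S" "\<forall>A\<in>S. \<forall>B\<in>S. \<not> arcs_cross A B"
  obtains T where "ideal_triangulation n T" "S \<subseteq> T"
proof -
  define F where "F = {T. S \<subseteq> T \<and> T \<subseteq> arcs n \<and> (\<forall>A\<in>T. \<forall>B\<in>T. \<not> arcs_cross A B)}"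
  have "finite F"
    unfolding F_def by (rule finite_subset[of _ "Pow (arcs n)"]) (auto simp: finite_arcs)
  moreover have "S \<in> F"
    using S unfolding F_def by simp
  ultimately obtain T where "T \<in> F" and T_max: "\<And>U. U \<in> F \<Longrightarrow> T \<subseteq> U \<Longrightarrow> T = U"
    by (metis finite_has_maximal2)
  then have T: "S \<subseteq> T" "T \<subseteq> arcs n" "\<forall>A\<in>T. \<forall>B\<in>T. \<not> arcs_cross A B"
    unfolding F_def by blast+
  have maximal: "\<exists>B\<in>T. arcs_cross D B" if D: "D \<in> arcs n" "D \<notin> T" for D
  proof (rule ccontr)
    assume *: "\<not> (\<exists>B\<in>T. arcs_cross D B)"
    obtain x y where "x < y" "D = {x, y}" using D(1) by (rule arcsE)
    then have "\<not> arcs_cross D D" by (simp add: arcs_cross_iff)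
    moreover have "\<not> arcs_cross D B" "\<not> arcs_cross B D" if "B \<in> T" for B
      using * that by (metis arcs_cross_commute)+
    ultimately have "insert D T \<in> F"
      using T D unfolding F_def by (simp add: subset_insertI2)
    then show False using T_max[of "insert D T"] D by blast
  qed
  have "ideal_triangulation n T"
    unfolding ideal_triangulation_def
    using T S(2) region_of_maximal_noncrossing[OF T(2,3) maximal] by blast
  then show thesis using that T(1) by blast
qed

text \<open>Through this lemma \<open>balanced\<close> yields the triangle inequalities for every
  triple of vertices. The three sides together with the frontier edges are non-crossing, and any
  triangulation containing them has the triangle as a region.\<close>

lemma triangle_in_ideal_triangulation:
  assumes ijk: "i < j" "j < k" "k < n"
  obtains T where "ideal_triangulation n T" "complementary_region n T {i, j, k}"
proof -
  have n: "2 \<le> n" using ijk by simp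
  let ?E = "{{i, j}, {j, k}, {i, k}}"
  let ?F = "frontier_edge n ` {..<n}"
  have E: "?E \<subseteq> arcs n" and F: "?F \<subseteq> arcs n"
    using ijk frontier_edge_in_arcs[OF n] by (auto intro!: arcsI)
  have "\<not> arcs_cross A B" if "A \<in> ?E \<union> ?F" "B \<in> ?E \<union> ?F" for A B
  proof (cases "A \<in> ?F \<or> B \<in> ?F")
    case True
    then show ?thesis
    proof
      assume "A \<in> ?F"
      then show ?thesis using that E F frontier_edge_not_cross[OF n] by auto
    next
      assume "B \<in> ?F"
      then have "\<not> arcs_cross B A" using that E F frontier_edge_not_cross[OF n] by auto
      then show ?thesis by (metis arcs_cross_commute)
    qed
  next
    case False
    then have "A \<in> ?E" "B \<in> ?E" using that by auto
    then show ?thesis using ijk by (auto simp: arcs_cross_iff)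
  qed
  then have "\<forall>A\<in>?E \<union> ?F. \<forall>B\<in>?E \<union> ?F. \<not> arcs_cross A B"
    by (intro ballI)
  moreover have "?E \<union> ?F \<subseteq> arcs n" "\<forall>p<n. frontier_edge n p \<in> ?E \<union> ?F"
    using E F by simp_all
  ultimately obtain T where T: "ideal_triangulation n T" "?E \<union> ?F \<subseteq> T"
    using extend_to_ideal_triangulation[of "?E \<union> ?F" n] by metis
  have sides: "sides {i, j, k} = ?E"
  proof
    show "sides {i, j, k} \<subseteq> ?E"
      unfolding sides_def using ijk by auto
    have "{x, y} \<in> sides {i, j, k}"
      if "x \<in> {i, j, k}" "y \<in> {i, j, k}" "x < y" "{i, j, k} \<inter> {x<..<y} = {} \<or> {i, j, k} \<subseteq> {x..y}" for x y
      using that unfolding sides_def by blast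
    from this[of i j] this[of j k] this[of i k] show "?E \<subseteq> sides {i, j, k}"
      using ijk by auto
  qed
  have "A \<in> ?E" if A: "A \<in> T" "A \<subseteq> {i, j, k}" for A
  proof -
    have "A \<in> arcs n" using T(1) A(1) unfolding ideal_triangulation_def by blast
    then obtain x y where "x < y" "A = {x, y}" by (rule arcsE)
    then show ?thesis using A(2) ijk by auto
  qed
  then have "complementary_region n T {i, j, k}"
    unfolding complementary_region_def sides using T(2) ijk by auto
  then show thesis using that T(1) by blast
qed

section \<open>Ultrametrics on the vertices\<close>

text \<open>Only distinct vertices are compared, since \<open>\<mu> {x, x}\<close> is the value at a
  singleton, which is not an arc.\<close>

definition vertex_ultrametric :: "nat \<Rightarrow> (nat set \<Rightarrow> real) \<Rightarrow> bool" where
  "vertex_ultrametric n \<mu> \<longleftrightarrow>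
     (\<forall>x<n. \<forall>y<n. \<forall>z<n. x \<noteq> y \<longrightarrow> y \<noteq> z \<longrightarrow> x \<noteq> z \<longrightarrow> \<mu> {x, z} \<le> max (\<mu> {x, y}) (\<mu> {y, z}))"

lemma balanced_imp_vertex_ultrametric:
  assumes "balanced n \<mu>"
  shows "vertex_ultrametric n \<mu>"
proof -
  have tri: "tropical_triangle_ineqs (\<mu> {i, j}) (\<mu> {j, k}) (\<mu> {k, i})"
    if "i < j" "j < k" "k < n" for i j k
    using triangle_in_ideal_triangulation[OF that] assms that unfolding balanced_def by metis
  show ?thesis
    unfolding vertex_ultrametric_def
  proof (intro allI impI)
    fix x y z assume "x < n" "y < n" "z < n" and ne: "x \<noteq> y" "y \<noteq> z" "x \<noteq> z"
    then show "\<mu> {x, z} \<le> max (\<mu> {x, y}) (\<mu> {y, z})"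
      using tri[of x y z] tri[of x z y] tri[of y x z] tri[of y z x] tri[of z x y] tri[of z y x]
      unfolding tropical_triangle_ineqs_def
      by (auto simp: insert_commute max.commute elim!: linorder_neqE_nat)
  qed
qed

text \<open>Equality is allowed explicitly: \<open>r\<close> may lie below every measure, and
  \<open>\<mu> {x}\<close> is arbitrary. For an ultrametric this is an equivalence relation on the
  vertices at every level \<open>r\<close>.\<close>

definition close :: "(nat set \<Rightarrow> real) \<Rightarrow> real \<Rightarrow> nat \<Rightarrow> nat \<Rightarrow> bool" where
  "close \<mu> r x y \<longleftrightarrow> x = y \<or> \<mu> {x, y} \<le> r"

lemma close_refl [simp]: "close \<mu> r x x"
  unfolding close_def by simp

lemma close_sym: "close \<mu> r x y \<Longrightarrow> close \<mu> r y x"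
  unfolding close_def by (auto simp: insert_commute)

lemma close_trans:
  assumes "vertex_ultrametric n \<mu>" "x < n" "y < n" "z < n" "close \<mu> r x y" "close \<mu> r y z"
  shows "close \<mu> r x z"
proof (cases "x = y \<or> y = z \<or> x = z")
  case True
  then show ?thesis using assms(5,6) by auto
next
  case False
  then have "\<mu> {x, z} \<le> max (\<mu> {x, y}) (\<mu> {y, z})"
    using assms unfolding vertex_ultrametric_def by blast
  then show ?thesis using assms(5,6) False unfolding close_def by auto
qed

section \<open>Boundary paths and the measures they bound\<close>

lemma close_frontier_edge:
  "\<mu> (frontier_edge n p) \<le> r \<Longrightarrow> close \<mu> r p (Suc p mod n)"
  unfolding close_def frontier_edge_def by blast

lemma close_path:
  assumes um: "vertex_ultrametric n \<mu>" and "i \<le> j" "j < n"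
    and "\<forall>p\<in>{i..<j}. \<mu> (frontier_edge n p) \<le> r"
  shows "close \<mu> r i j"
  using assms(2-)
proof (induction j rule: dec_induct)
  case base
  then show ?case by simp
next
  case (step j)
  have "close \<mu> r i j" using step by auto
  moreover have "close \<mu> r j (Suc j)"
    using close_frontier_edge[of \<mu> n j r] step by auto
  ultimately show ?case
    using close_trans[OF um, of i j "Suc j"] step by auto
qed

text \<open>The complementary path runs from \<open>j\<close> up to \<open>n - 1\<close>, over the
  frontier edge \<open>n - 1\<close> to vertex \<open>0\<close>, and up to \<open>i\<close>. As
  \<open>j < n\<close>, that wrapping edge is never among the edges from \<open>i\<close> to
  \<open>j\<close>.\<close>

lemma close_outer_path:
  assumes um: "vertex_ultrametric n \<mu>" and "i < j" "j < n"
    and edges: "\<forall>p\<in>{..<n} - {i..<j}. \<mu> (frontier_edge n p) \<le> r"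
  shows "close \<mu> r i j"
proof -
  have "close \<mu> r 0 i" "close \<mu> r j (n - 1)"
    using assms by (auto intro!: close_path[OF um])
  moreover have "close \<mu> r (n - 1) 0"
    using close_frontier_edge[of \<mu> n "n - 1" r] assms(2,3) edges[rule_format, of "n - 1"]
    by fastforce
  ultimately show ?thesis
    using close_trans[OF um] assms(2,3) close_sym
    by (metis diff_less less_imp_Suc_add less_trans zero_less_Suc zero_less_one)
qed

lemma paths_bounded_by_measure:
  assumes um: "vertex_ultrametric n \<mu>" and ml: "measured_lamination n \<mu>" and ij: "i < j" "j < n"
  shows "(\<forall>p\<in>{i..<j}. \<mu> (frontier_edge n p) \<le> \<mu> {i, j}) \<or>
         (\<forall>p\<in>{..<n} - {i..<j}. \<mu> (frontier_edge n p) \<le> \<mu> {i, j})"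
proof (rule ccontr)
  define r where "r = \<mu> {i, j}"
  have wij: "close \<mu> r i j" unfolding r_def close_def by simp
  \<comment> \<open>An edge longer than \<open>r\<close> cannot have both ends in the class of
    \<open>i\<close>.\<close>
  have far: "\<not> close \<mu> r i p \<or> \<not> close \<mu> r i (Suc p mod n)"
    if "p < n" "r < \<mu> (frontier_edge n p)" for p
  proof (rule ccontr)
    assume "\<not> ?thesis"
    then have "close \<mu> r p (Suc p mod n)"
      using close_trans[OF um, of p i "Suc p mod n"] close_sym that ij by auto
    moreover have "p \<noteq> Suc p mod n"
      using that ij by (cases "Suc p = n") auto
    ultimately show False
      using that unfolding close_def frontier_edge_def by auto
  qed
  assume "\<not> ?thesis"
  then obtain e f where e: "e \<in> {i..<j}" "r < \<mu> (frontier_edge n e)"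
    and f: "f \<in> {..<n} - {i..<j}" "r < \<mu> (frontier_edge n f)"
    unfolding r_def by (meson not_le)
  \<comment> \<open>Both ends of \<open>e\<close> lie between \<open>i\<close> and \<open>j\<close>
    inclusive. An end that is not close to \<open>i\<close> is neither \<open>i\<close> nor
    \<open>j\<close>, hence lies strictly between.\<close>
  obtain p where p: "i < p" "p < j" "\<not> close \<mu> r i p"
  proof -
    have "Suc e mod n = Suc e" using e ij by simp
    then have "\<not> close \<mu> r i e \<or> \<not> close \<mu> r i (Suc e)"
      using far[of e] e ij by auto
    then show thesis
      using that[of e] that[of "Suc e"] e wij
      by (metis Suc_leI atLeastLessThan_iff le_imp_less_Suc order_le_less close_refl)
  qed
  obtain q where q: "q < i \<or> j < q" "q < n" "\<not> close \<mu> r i q"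
  proof -
    have f': "f < i \<or> j \<le> f" "f < n" using f by auto
    \<comment> \<open>For \<open>f = n - 1\<close> the second end wraps round to \<open>0\<close>,
      which still lies on the outer path.\<close>
    then have "Suc f mod n \<le> i \<or> j \<le> Suc f mod n" "Suc f mod n < n"
      using ij by (cases "Suc f = n"; auto)+
    then show thesis
      using that[of f] that[of "Suc f mod n"] f' far[of f] f(2) wij
      by (metis order_le_less close_refl)
  qed
  \<comment> \<open>In an ultrametric triangle the two largest sides agree; here
    \<open>{i, j}\<close> is strictly shorter than \<open>{i, v}\<close>.\<close>
  have eq: "\<mu> {i, v} = \<mu> {j, v} \<and> r < \<mu> {i, v}" if v: "v < n" "v \<noteq> j" "\<not> close \<mu> r i v" for v
  proof -
    have "v \<noteq> i" "r < \<mu> {i, v}" using v unfolding close_def by auto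
    moreover have "\<mu> {i, v} \<le> max (\<mu> {i, j}) (\<mu> {j, v})" "\<mu> {j, v} \<le> max (\<mu> {j, i}) (\<mu> {i, v})"
      using um v ij \<open>v \<noteq> i\<close> unfolding vertex_ultrametric_def by (metis less_trans nat_neq_iff)+
    ultimately show ?thesis
      unfolding r_def by (auto simp: insert_commute max_def split: if_splits)
  qed
  have pq: "\<mu> {p, q} \<le> max (\<mu> {i, p}) (\<mu> {i, q})"
  proof -
    have "p < n" "i < n" "q \<noteq> i" "p \<noteq> i" "p \<noteq> q" using p q ij by auto
    then have "\<mu> {p, q} \<le> max (\<mu> {p, i}) (\<mu> {i, q})"
      using um q(2) unfolding vertex_ultrametric_def by metis
    then show ?thesis by (simp add: insert_commute)
  qed
  \<comment> \<open>In either position of \<open>q\<close>, the arcs \<open>{i, j}\<close> and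
    \<open>{p, q}\<close> are the diagonals of a quadrilateral. By \<open>eq\<close> both sums of
    opposite sides coincide, so the maximum in the Ptolemy equation disappears.\<close>
  have "r + \<mu> {p, q} = \<mu> {i, p} + \<mu> {i, q}"
    using q(1)
  proof
    assume "q < i"
    then have "\<mu> {q, p} + \<mu> {i, j} = max (\<mu> {q, i} + \<mu> {p, j}) (\<mu> {i, p} + \<mu> {j, q})"
      using ml p ij unfolding measured_lamination_def by blast
    then show ?thesis
      using eq[of p] eq[of q] p q ij \<open>q < i\<close> unfolding r_def by (auto simp: insert_commute)
  next
    assume "j < q"
    then have "\<mu> {i, j} + \<mu> {p, q} = max (\<mu> {i, p} + \<mu> {j, q}) (\<mu> {p, j} + \<mu> {q, i})"
      using ml p q unfolding measured_lamination_def by blast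
    then show ?thesis
      using eq[of p] eq[of q] p q ij \<open>j < q\<close> unfolding r_def by (auto simp: insert_commute)
  qed
  then show False
    using pq eq[of p] eq[of q] p q ij by (auto simp: max_def split: if_splits)
qed

section \<open>Uniqueness, and necessity of the frontier inequalities\<close>

lemma measure_le_of_frontier_eq:
  assumes "measured_lamination n \<nu>" "vertex_ultrametric n \<mu>" "vertex_ultrametric n \<nu>"
    and "\<forall>p<n. \<mu> (frontier_edge n p) = \<nu> (frontier_edge n p)" and ij: "i < j" "j < n"
  shows "\<mu> {i, j} \<le> \<nu> {i, j}"
proof -
  \<comment> \<open>Some boundary path has all its edges bounded by \<open>\<nu> {i, j}\<close>. Its
    edges have the same measures under \<open>\<mu>\<close>, so the ultrametric inequality along it
    bounds \<open>\<mu> {i, j}\<close>.\<close>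
  have "close \<mu> (\<nu> {i, j}) i j"
    using paths_bounded_by_measure[OF assms(3,1) ij]
  proof
    assume "\<forall>p\<in>{i..<j}. \<nu> (frontier_edge n p) \<le> \<nu> {i, j}"
    then show ?thesis using assms by (intro close_path) auto
  next
    assume "\<forall>p\<in>{..<n} - {i..<j}. \<nu> (frontier_edge n p) \<le> \<nu> {i, j}"
    then show ?thesis using assms by (intro close_outer_path) auto
  qed
  then show ?thesis using ij unfolding close_def by simp
qed

lemma balanced_lamination_unique:
  assumes "measured_lamination n \<mu>" "balanced n \<mu>" "measured_lamination n \<nu>" "balanced n \<nu>"
    and "\<forall>p<n. \<mu> (frontier_edge n p) = \<nu> (frontier_edge n p)" "A \<in> arcs n"
  shows "\<mu> A = \<nu> A"
proof -
  obtain i j where "i < j" "j < n" "A = {i, j}"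
    using assms(6) by (rule arcsE)
  then show ?thesis
    using assms measure_le_of_frontier_eq balanced_imp_vertex_ultrametric
    by (metis order_antisym)
qed

text \<open>The remaining frontier edges form a path between the ends of edge \<open>i\<close>, and
  the ultrametric inequality applies along it.\<close>

lemma frontier_edge_le_Max:
  assumes um: "vertex_ultrametric n \<mu>" and n: "3 \<le> n" and i: "i < n"
    and a: "\<forall>p<n. \<mu> (frontier_edge n p) = a p"
  shows "a i \<le> Max (a ` ({..<n} - {i}))" (is "_ \<le> ?r")
proof -
  have r: "a p \<le> ?r" if "p < n" "p \<noteq> i" for p
    using that by (intro Max_ge) auto
  show ?thesis
    using frontier_edge_cases[OF i]
  proof
    assume *: "Suc i < n \<and> frontier_edge n i = {i, Suc i}"
    then have "close \<mu> ?r i (Suc i)"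
      using a r by (intro close_outer_path[OF um]) auto
    then have "\<mu> {i, Suc i} \<le> ?r" unfolding close_def by simp
    then show ?thesis using * a i by metis
  next
    assume *: "Suc i = n \<and> frontier_edge n i = {0, i}"
    then have "close \<mu> ?r 0 i"
      using a r by (intro close_path[OF um]) auto
    then have "\<mu> {0, i} \<le> ?r" using * n unfolding close_def by auto
    then show ?thesis using * a i by metis
  qed
qed

section \<open>The lamination with given frontier measures\<close>

text \<open>\<open>Min A\<close> and \<open>Max A\<close> recover the ends \<open>i < j\<close> of
  an arc. Frontier edge \<open>p\<close> starts at vertex \<open>p\<close>, so the two index sets
  are the two boundary paths; for \<open>j < n\<close> they contain \<open>i\<close> and
  \<open>j\<close> respectively, so neither \<open>Max\<close> is over an empty set.\<close>

definition minmax_measure :: "nat \<Rightarrow> (nat \<Rightarrow> real) \<Rightarrow> nat set \<Rightarrow> real" where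
  "minmax_measure n a A =
     min (Max (a ` {Min A..<Max A})) (Max (a ` ({..<n} - {Min A..<Max A})))"

lemma minmax_measure_arc:
  "i < j \<Longrightarrow> minmax_measure n a {i, j} = min (Max (a ` {i..<j})) (Max (a ` ({..<n} - {i..<j})))"
  "i < j \<Longrightarrow> minmax_measure n a {j, i} = min (Max (a ` {i..<j})) (Max (a ` ({..<n} - {i..<j})))"
  unfolding minmax_measure_def by (simp_all add: max_def min_def)

lemma Max_image_Un:
  "finite X \<Longrightarrow> X \<noteq> {} \<Longrightarrow> finite Y \<Longrightarrow> Y \<noteq> {} \<Longrightarrow>
    Max (f ` (X \<union> Y)) = max (Max (f ` X)) (Max (f ` Y) :: real)"
  by (simp add: image_Un Max_Un)

text \<open>The identity is invariant under cyclic rotation of \<open>A\<close>, \<open>B\<close>,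
  \<open>C\<close>, \<open>D\<close>, so \<open>D\<close> may be taken largest. The left side is
  then \<open>max A B + max B C\<close>, the right side
  \<open>max (A + C) (B + max A (max B C))\<close>, and both are the largest of
  \<open>A + B\<close>, \<open>A + C\<close>, \<open>B + B\<close>, \<open>B + C\<close>.\<close>

lemma min_max_ptolemy:
  fixes A B C D :: real
  shows "min (max A B) (max C D) + min (max B C) (max A D) =
    max (min A (max B (max C D)) + min C (max A (max B D)))
        (min B (max A (max C D)) + min (max A (max B C)) D)"
  unfolding max_def min_def by (smt (verit))

lemma measured_lamination_minmax: "measured_lamination n (minmax_measure n a)"
  unfolding measured_lamination_def
proof (intro allI impI)
  fix i j k l assume "i < j \<and> j < k \<and> k < l \<and> l < n"
  then have *: "i < j" "j < k" "k < l" "l < n" by auto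
  let ?I = "{i..<j}" and ?J = "{j..<k}" and ?K = "{k..<l}"
  \<comment> \<open>The quadrilateral cuts the boundary into four paths. \<open>L\<close> is the one
    from \<open>l\<close> back to \<open>i\<close> through the wrapping edge.\<close>
  define L where "L = {..<n} - {i..<l}"
  have ne: "?I \<noteq> {}" "?J \<noteq> {}" "?K \<noteq> {}" "l \<in> L"
    using * unfolding L_def by auto
  have sets: "{i..<k} = ?I \<union> ?J" "{j..<l} = ?J \<union> ?K" "{i..<l} = ?I \<union> (?J \<union> ?K)"
    and co_sets: "{..<n} - {i..<j} = ?J \<union> (?K \<union> L)" "{..<n} - {j..<k} = ?I \<union> (?K \<union> L)"
    "{..<n} - {k..<l} = ?I \<union> (?J \<union> L)"
    "{..<n} - {i..<k} = ?K \<union> L" "{..<n} - {j..<l} = ?I \<union> L"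
    using * unfolding L_def by auto
  define A B C D where "A = Max (a ` ?I)" and "B = Max (a ` ?J)" and "C = Max (a ` ?K)"
    and "D = Max (a ` L)"
  have L: "finite L" "L \<noteq> {}" using ne(4) by (auto simp: L_def)
  have U: "Max (a ` {i..<k}) = max A B" "Max (a ` {j..<l}) = max B C"
    "Max (a ` {i..<l}) = max A (max B C)"
    "Max (a ` ({..<n} - {i..<j})) = max B (max C D)"
    "Max (a ` ({..<n} - {j..<k})) = max A (max C D)"
    "Max (a ` ({..<n} - {k..<l})) = max A (max B D)"
    "Max (a ` ({..<n} - {i..<k})) = max C D" "Max (a ` ({..<n} - {j..<l})) = max A D"
    unfolding co_sets unfolding sets A_def B_def C_def D_def using ne L
    by (simp_all only: Max_image_Un finite_Un finite_atLeastLessThan Un_empty simp_thms)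
  have "i < k" "j < l" "i < l"
    using * by simp_all
  then show "minmax_measure n a {i, k} + minmax_measure n a {j, l} =
      max (minmax_measure n a {i, j} + minmax_measure n a {k, l})
          (minmax_measure n a {j, k} + minmax_measure n a {l, i})"
    unfolding minmax_measure_arc[OF *(1)] minmax_measure_arc[OF *(2)] minmax_measure_arc[OF *(3)]
      minmax_measure_arc[OF \<open>i < k\<close>] minmax_measure_arc[OF \<open>j < l\<close>] minmax_measure_arc[OF \<open>i < l\<close>]
      U A_def[symmetric] B_def[symmetric] C_def[symmetric] D_def[symmetric] L_def[symmetric]
    by (intro min_max_ptolemy)
qed

lemma balanced_minmax: "balanced n (minmax_measure n a)"
  unfolding balanced_def
proof (intro allI impI)
  fix T i j k assume "i < j \<and> j < k \<and> complementary_region n T {i, j, k}"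
  then have *: "i < j" "j < k" "k < n"
    unfolding complementary_region_def by auto
  let ?I = "{i..<j}" and ?J = "{j..<k}"
  define K where "K = {..<n} - {i..<k}"
  have ne: "?I \<noteq> {}" "?J \<noteq> {}" "k \<in> K"
    using * unfolding K_def by auto
  have sets: "{i..<k} = ?I \<union> ?J"
    and co_sets: "{..<n} - {i..<j} = ?J \<union> K" "{..<n} - {j..<k} = ?I \<union> K"
    using * unfolding K_def by auto
  define A B C where "A = Max (a ` ?I)" and "B = Max (a ` ?J)" and "C = Max (a ` K)"
  have K: "finite K" "K \<noteq> {}" using ne(3) by (auto simp: K_def)
  have U: "Max (a ` {i..<k}) = max A B" "Max (a ` ({..<n} - {i..<j})) = max B C"
    "Max (a ` ({..<n} - {j..<k})) = max A C"
    unfolding co_sets unfolding sets A_def B_def C_def using ne K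
    by (simp_all only: Max_image_Un finite_atLeastLessThan simp_thms)
  \<comment> \<open>If \<open>C\<close> is the largest, the three sides are \<open>A\<close>,
    \<open>B\<close> and \<open>max A B\<close>; the other cases are the same up to
    permutation.\<close>
  have "tropical_triangle_ineqs (min A (max B C)) (min B (max A C)) (min (max A B) C)"
    unfolding tropical_triangle_ineqs_def by (auto simp: max_def min_def)
  then show "tropical_triangle_ineqs (minmax_measure n a {i, j}) (minmax_measure n a {j, k})
      (minmax_measure n a {k, i})"
    using * by (simp add: minmax_measure_arc U flip: A_def B_def C_def K_def)
qed

text \<open>One of the two paths is the edge \<open>i\<close> alone and the other consists of all
  remaining edges, so the hypothesis says exactly that the minimum is \<open>a i\<close>.\<close>

lemma minmax_measure_frontier:
  assumes "2 \<le> n" "i < n" "a i \<le> Max (a ` ({..<n} - {i}))"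
  shows "minmax_measure n a (frontier_edge n i) = a i"
  using frontier_edge_cases[OF assms(2)]
proof
  assume *: "Suc i < n \<and> frontier_edge n i = {i, Suc i}"
  have "{i..<Suc i} = {i}" by auto
  then show ?thesis using * assms by (simp add: minmax_measure_arc)
next
  assume *: "Suc i = n \<and> frontier_edge n i = {0, i}"
  then have "0 < i" "{..<n} - {0..<i} = {i}" "{0..<i} = {..<n} - {i}"
    using assms by auto
  then show ?thesis using * assms by (simp add: minmax_measure_arc)
qed

theorem proposition3p5:
  fixes n :: nat and a :: "nat \<Rightarrow> real"
  assumes "3 \<le> n" and "\<forall>i<n. 0 < a i"
  shows "((\<exists>\<mu>. measured_lamination n \<mu> \<and> balanced n \<mu> \<and> (\<forall>i<n. \<mu> (frontier_edge n i) = a i))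
            \<longleftrightarrow> (\<forall>i<n. a i \<le> Max (a ` ({..<n} - {i})))) \<and>
         (\<forall>\<mu> \<nu>. measured_lamination n \<mu> \<and> balanced n \<mu> \<and> (\<forall>i<n. \<mu> (frontier_edge n i) = a i) \<and>
                measured_lamination n \<nu> \<and> balanced n \<nu> \<and> (\<forall>i<n. \<nu> (frontier_edge n i) = a i)
            \<longrightarrow> (\<forall>A\<in>arcs n. \<mu> A = \<nu> A))"
proof (intro conjI iffI)
  assume "\<exists>\<mu>. measured_lamination n \<mu> \<and> balanced n \<mu> \<and> (\<forall>i<n. \<mu> (frontier_edge n i) = a i)"
  then show "\<forall>i<n. a i \<le> Max (a ` ({..<n} - {i}))"
    using frontier_edge_le_Max[OF _ assms(1)] balanced_imp_vertex_ultrametric by blast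
next
  assume "\<forall>i<n. a i \<le> Max (a ` ({..<n} - {i}))"
  then have "\<forall>i<n. minmax_measure n a (frontier_edge n i) = a i"
    using assms(1) by (simp add: minmax_measure_frontier)
  then show "\<exists>\<mu>. measured_lamination n \<mu> \<and> balanced n \<mu> \<and> (\<forall>i<n. \<mu> (frontier_edge n i) = a i)"
    using measured_lamination_minmax balanced_minmax by blast
next
  have "\<mu> A = \<nu> A"
    if "measured_lamination n \<mu> \<and> balanced n \<mu> \<and> (\<forall>i<n. \<mu> (frontier_edge n i) = a i) \<and>
      measured_lamination n \<nu> \<and> balanced n \<nu> \<and> (\<forall>i<n. \<nu> (frontier_edge n i) = a i)" "A \<in> arcs n"
    for \<mu> \<nu> A
    using that by (intro balanced_lamination_unique[of n \<mu> \<nu>]) auto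
  then show "\<forall>\<mu> \<nu>. measured_lamination n \<mu> \<and> balanced n \<mu> \<and> (\<forall>i<n. \<mu> (frontier_edge n i) = a i) \<and>
      measured_lamination n \<nu> \<and> balanced n \<nu> \<and> (\<forall>i<n. \<nu> (frontier_edge n i) = a i)
      \<longrightarrow> (\<forall>A\<in>arcs n. \<mu> A = \<nu> A)"
    by blast
qed

end
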